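(* Let $N\ge 3$ be an odd integer and let $(a_k)_{1\le k\le N}$ be a sequence of positive integers with $a_1=1$ such that the antitree $G=\mathcal{AT}((a_k))$ is symmetrical, i.e. $a_k=a_{N+1-k}$ for all $k$. Let $L=\operatorname{diam}(G)$. Then $G$ is Bonnet-Myers sharp if and only if every radial edge $x\sim y$ of $G$ satisfies $\kappa_{LLY}(x,y)=2/L$.
   Context: For a sequence of positive integers $(a_k)_{1\le k\le N}$, the antitree $\mathcal{AT}((a_k))$ has vertex set the disjoint union $V_1\cup\cdots\cup V_N$ with $|V_k|=a_k$; any two distinct vertices in the same $V_k$ are adjacent, every vertex of $V_k$ is adjacent to every vertex of $V_{k+1}$ ($1\le k<N$), and there are no other edges. Edges between vertices of different sets $V_k$ are called radial edges; edges within one $V_k$ are spherical edges. Graphs are finite and simple; $d(x,y)$ is graph distance, $d_x$ the degree. For $p\in[0,1]$ let $\mu_x^p(z)=p$ if $z=x$, $\frac{1-p}{d_x}$ if $z\sim x$, $0$ otherwise. $W_1(\mu_1,\mu_2)=\inf_\pi\sum_{x,y}d(x,y)\pi(x,y)$ over couplings $\pi$ of $\mu_1,\mu_2$. For an edge $x\sim y$, $\kappa_p(x,y)=1-W_1(\mu_x^p,\mu_y^p)$ and $\kappa_{LLY}(x,y)=\lim_{p\to1}\kappa_p(x,y)/(1-p)$. A graph $G$ is Bonnet-Myers sharp if $\inf_{x\sim y}\kappa_{LLY}(x,y)=2/\operatorname{diam}(G)$. *)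

theory Defs
  imports "HOL-Analysis.Analysis" "Graph_Theory.Graph_Theory"
begin

text \<open>
  A finite simple graph is a \<^locale>\<open>pair_graph\<close>: finite vertex set, symmetric irreflexive arc
  relation. Each edge \<open>x \<sim> y\<close> thus occurs as the two arcs \<open>(x, y)\<close> and \<open>(y, x)\<close>.
\<close>

context pair_graph
begin

text \<open>
  Graph distance: the shortest-path distance for unit weights. If \<open>x\<close> and \<open>y\<close> are not connected,
  \<open>\<mu>\<close> is infinite and \<open>real_of_ereal\<close> turns it into \<open>0\<close>, so this is the usual distance only on
  connected graphs.
\<close>

definition graph_dist :: "'a \<Rightarrow> 'a \<Rightarrow> real" where
  "graph_dist x y = real_of_ereal (\<mu> (\<lambda>_. 1) x y)"

definition graph_diam :: real where
  "graph_diam = (MAX (x, y) \<in> pverts G \<times> pverts G. graph_dist x y)"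

definition walk_measure :: "real \<Rightarrow> 'a \<Rightarrow> 'a \<Rightarrow> real" where
  "walk_measure p x z =
     (if z = x then p
      else if (x, z) \<in> parcs G then (1 - p) / real (out_degree G x)
      else 0)"

definition couplings :: "('a \<Rightarrow> real) \<Rightarrow> ('a \<Rightarrow> real) \<Rightarrow> ('a \<Rightarrow> 'a \<Rightarrow> real) set" where
  "couplings m1 m2 = {\<pi>.
     (\<forall>x\<in>pverts G. \<forall>y\<in>pverts G. 0 \<le> \<pi> x y) \<and>
     (\<forall>x\<in>pverts G. (\<Sum>y\<in>pverts G. \<pi> x y) = m1 x) \<and>
     (\<forall>y\<in>pverts G. (\<Sum>x\<in>pverts G. \<pi> x y) = m2 y)}"

definition wasserstein1 :: "('a \<Rightarrow> real) \<Rightarrow> ('a \<Rightarrow> real) \<Rightarrow> real" where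
  "wasserstein1 m1 m2 =
     (INF \<pi> \<in> couplings m1 m2. \<Sum>x\<in>pverts G. \<Sum>y\<in>pverts G. graph_dist x y * \<pi> x y)"

definition kappa :: "real \<Rightarrow> 'a \<Rightarrow> 'a \<Rightarrow> real" where
  "kappa p x y = 1 - wasserstein1 (walk_measure p x) (walk_measure p y)"

text \<open>The limit is one-sided because the idleness \<open>p\<close> ranges over \<open>[0, 1]\<close>.\<close>

definition kappa_LLY :: "'a \<Rightarrow> 'a \<Rightarrow> real" where
  "kappa_LLY x y = Lim (at_left 1) (\<lambda>p. kappa p x y / (1 - p))"

definition bonnet_myers_sharp :: bool where
  "bonnet_myers_sharp \<longleftrightarrow> (INF (x, y) \<in> parcs G. kappa_LLY x y) = 2 / graph_diam"

end

text \<open>The vertex set is the disjoint union of the layers \<open>V\<^sub>k = {k} \<times> {1..a k}\<close>, \<open>1 \<le> k \<le> N\<close>.\<close>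

definition antitree_verts :: "nat \<Rightarrow> (nat \<Rightarrow> nat) \<Rightarrow> (nat \<times> nat) set" where
  "antitree_verts N a = (SIGMA k:{1..N}. {1..a k})"

definition antitree :: "nat \<Rightarrow> (nat \<Rightarrow> nat) \<Rightarrow> (nat \<times> nat) pair_pre_digraph" where
  "antitree N a =
     \<lparr> pverts = antitree_verts N a,
       parcs = {(x, y) \<in> antitree_verts N a \<times> antitree_verts N a.
                  x \<noteq> y \<and> (fst x = fst y \<or> fst y = Suc (fst x) \<or> fst x = Suc (fst y))} \<rparr>"

definition radial_edges :: "nat \<Rightarrow> (nat \<Rightarrow> nat) \<Rightarrow> ((nat \<times> nat) \<times> (nat \<times> nat)) set" where
  "radial_edges N a = {(x, y) \<in> parcs (antitree N a). fst x \<noteq> fst y}"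

lemma pair_graph_antitree: "pair_graph (antitree N a)"
proof -
  have fin: "finite (antitree_verts N a)"
    by (simp add: antitree_verts_def)
  have "finite (parcs (antitree N a))"
    by (rule finite_subset[of _ "antitree_verts N a \<times> antitree_verts N a"])
      (auto simp: antitree_def fin)
  then show ?thesis
    by unfold_locales
      (auto simp: antitree_def fin symmetric_def sym_def arcs_ends_def arc_to_ends_def)
qed

end

theory Submission
  imports Defs
begin

text \<open>
  The layer index is 1-Lipschitz, and testing the transport problems with it along a path from
  \<open>V\<^sub>1\<close> to \<open>V\<^sub>N\<close> with one vertex per layer shows that the \<open>L\<close> curvatures of its edges sum to at most
  2. If all of them are at least \<open>2 / L\<close>, they therefore equal \<open>2 / L\<close>; and every radial edge lies
  on such a path. Conversely, the ends of a spherical edge have the same closed neighbourhood, so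
  its curvature is at least \<open>1 \<ge> 2 / L\<close> and only radial edges matter for sharpness.
\<close>

text \<open>Curvature is defined by a left limit at 1. Monotonicity and boundedness make that limit
  exist and identify it with a supremum, so each single value is a lower bound for it.\<close>

lemma tendsto_at_left_mono_bounded:
  fixes f :: "real \<Rightarrow> real"
  assumes "a < b"
    and mono: "\<And>p q. a \<le> p \<Longrightarrow> p < q \<Longrightarrow> q < b \<Longrightarrow> f p \<le> f q"
    and bound: "\<And>p. a \<le> p \<Longrightarrow> p < b \<Longrightarrow> f p \<le> B"
  shows "(f \<longlongrightarrow> (SUP p\<in>{a..<b}. f p)) (at_left b)"
proof (rule increasing_tendsto)
  have bdd: "bdd_above (f ` {a..<b})"
    by (rule bdd_aboveI2[of _ _ B]) (use bound in auto)
  show "\<forall>\<^sub>F p in at_left b. f p \<le> (SUP p\<in>{a..<b}. f p)"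
    unfolding eventually_at_left_field
    using \<open>a < b\<close> bdd by (intro exI[of _ a]) (auto intro!: cSUP_upper)
  fix x assume "x < (SUP p\<in>{a..<b}. f p)"
  then obtain p where p: "p \<in> {a..<b}" "x < f p"
    using \<open>a < b\<close> bdd by (auto simp: less_cSUP_iff)
  show "\<forall>\<^sub>F q in at_left b. x < f q"
    unfolding eventually_at_left_field
    using p mono[of p] by (intro exI[of _ p]) (auto intro: less_le_trans)
qed

section \<open>Graph distance as minimal walk length\<close>

context pair_graph
begin

definition neighbors :: "'a \<Rightarrow> 'a set" where
  "neighbors x = {u. (x, u) \<in> parcs G}"

definition transport_cost :: "('a \<Rightarrow> 'a \<Rightarrow> real) \<Rightarrow> real" where
  "transport_cost \<pi> = (\<Sum>u\<in>pverts G. \<Sum>v\<in>pverts G. graph_dist u v * \<pi> u v)"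

lemma neighbors_subset: "neighbors x \<subseteq> pverts G"
  by (auto simp: neighbors_def dest: in_arcsD2)

lemma finite_neighbors [simp]: "finite (neighbors x)"
  using neighbors_subset pair_finite_verts by (rule finite_subset)

lemma not_in_neighbors [simp]: "x \<notin> neighbors x"
  by (auto simp: neighbors_def dest: no_loops')

lemma out_degree_eq_card_neighbors: "out_degree G x = card (neighbors x)"
proof -
  have "out_arcs G x = Pair x ` neighbors x"
    by (auto simp: out_arcs_def neighbors_def)
  then show ?thesis
    by (simp add: out_degree_def card_image inj_on_def)
qed

lemma out_degree_pos: "(x, y) \<in> parcs G \<Longrightarrow> 0 < out_degree G x"
  by (auto simp: out_degree_eq_card_neighbors card_gt_0_iff neighbors_def[of x]
      finite_neighbors[unfolded neighbors_def])

lemma awalk_cost_unit: "awalk_cost (\<lambda>_. 1) p = real (length p)"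
  by (induction p) auto

lemma shortest_path_unit_nonneg: "0 \<le> \<mu> (\<lambda>_. 1) u v"
  unfolding \<mu>_def by (rule INF_greatest) (simp add: awalk_cost_unit)

lemma graph_dist_nonneg: "0 \<le> graph_dist u v"
  unfolding graph_dist_def by (rule real_of_ereal_pos[OF shortest_path_unit_nonneg])

lemma graph_dist_le_length:
  assumes "awalk u p v"
  shows "graph_dist u v \<le> real (length p)"
proof -
  have "\<mu> (\<lambda>_. 1) u v \<le> ereal (real (length p))"
    using min_cost_le_walk_cost[OF assms, of "\<lambda>_. 1"] by (simp add: awalk_cost_unit)
  then show ?thesis
    unfolding graph_dist_def using shortest_path_unit_nonneg[of u v]
    by (cases "\<mu> (\<lambda>_. 1) u v") auto
qed

text \<open>The walk \<open>q\<close> keeps the infimum finite. For unconnected vertices the second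
  assumption would hold vacuously for every \<open>c\<close>, while \<open>graph_dist\<close> takes
  the default value 0.\<close>

lemma le_graph_dist:
  assumes "awalk u q v" and "\<And>p. awalk u p v \<Longrightarrow> c \<le> real (length p)"
  shows "c \<le> graph_dist u v"
proof -
  have "ereal c \<le> \<mu> (\<lambda>_. 1) u v"
    unfolding \<mu>_def by (rule INF_greatest) (use assms(2) in \<open>simp add: awalk_cost_unit\<close>)
  moreover have "\<mu> (\<lambda>_. 1) u v \<le> ereal (real (length q))"
    using min_cost_le_walk_cost[OF assms(1), of "\<lambda>_. 1"] by (simp add: awalk_cost_unit)
  ultimately show ?thesis
    unfolding graph_dist_def by (cases "\<mu> (\<lambda>_. 1) u v") auto
qed

lemma graph_dist_self [simp]: "u \<in> pverts G \<Longrightarrow> graph_dist u u = 0"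
  using graph_dist_le_length[of u "[]" u] graph_dist_nonneg[of u u]
  by (simp add: awalk_Nil_iff)

lemma length_rev_path [simp]: "length (rev_path p) = length p"
  by (induction p) auto

lemma graph_dist_sym_le:
  assumes "awalk u q v"
  shows "graph_dist u v \<le> graph_dist v u"
proof (rule le_graph_dist)
  show "awalk v (rev_path q) u" using assms by simp
  fix p assume "awalk v p u"
  then have "awalk u (rev_path p) v" by simp
  then show "graph_dist u v \<le> real (length p)"
    using graph_dist_le_length by fastforce
qed

section \<open>Couplings and transport cost\<close>

lemma transport_cost_nonneg: "\<pi> \<in> couplings m1 m2 \<Longrightarrow> 0 \<le> transport_cost \<pi>"
  unfolding transport_cost_def couplings_def
  by (auto intro!: sum_nonneg mult_nonneg_nonneg graph_dist_nonneg)

lemma wasserstein1_eq: "wasserstein1 m1 m2 = (INF \<pi>\<in>couplings m1 m2. transport_cost \<pi>)"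
  unfolding wasserstein1_def transport_cost_def ..

lemma wasserstein1_le:
  assumes "\<pi> \<in> couplings m1 m2"
  shows "wasserstein1 m1 m2 \<le> transport_cost \<pi>"
  unfolding wasserstein1_eq
  by (rule cINF_lower[OF _ assms]) (auto intro!: bdd_belowI2[of _ 0] transport_cost_nonneg)

text \<open>The easy half of Kantorovich duality: for any coupling the difference of the two
  expectations is the \<open>\<pi>\<close>-weighted sum of \<open>f u - f v\<close>, and each such
  difference is at most the distance. Nonemptiness makes the infimum over couplings
  meaningful.\<close>

lemma wasserstein1_ge:
  assumes "couplings m1 m2 \<noteq> {}"
    and lip: "\<And>u v. u \<in> pverts G \<Longrightarrow> v \<in> pverts G \<Longrightarrow> f u - f v \<le> graph_dist u v"
  shows "(\<Sum>u\<in>pverts G. f u * m1 u) - (\<Sum>u\<in>pverts G. f u * m2 u) \<le> wasserstein1 m1 m2"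
  unfolding wasserstein1_eq
proof (rule cINF_greatest[OF assms(1)])
  fix \<pi> assume "\<pi> \<in> couplings m1 m2"
  then have nn: "\<And>u v. u \<in> pverts G \<Longrightarrow> v \<in> pverts G \<Longrightarrow> 0 \<le> \<pi> u v"
    and m1: "\<And>u. u \<in> pverts G \<Longrightarrow> (\<Sum>v\<in>pverts G. \<pi> u v) = m1 u"
    and m2: "\<And>v. v \<in> pverts G \<Longrightarrow> (\<Sum>u\<in>pverts G. \<pi> u v) = m2 v"
    by (auto simp: couplings_def)
  have "(\<Sum>u\<in>pverts G. f u * m1 u) = (\<Sum>u\<in>pverts G. \<Sum>v\<in>pverts G. f u * \<pi> u v)"
    by (intro sum.cong refl) (simp add: m1[symmetric] sum_distrib_left)
  moreover have "(\<Sum>v\<in>pverts G. f v * m2 v) = (\<Sum>v\<in>pverts G. \<Sum>u\<in>pverts G. f v * \<pi> u v)"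
    by (intro sum.cong refl) (simp add: m2[symmetric] sum_distrib_left)
  moreover have "\<dots> = (\<Sum>u\<in>pverts G. \<Sum>v\<in>pverts G. f v * \<pi> u v)"
    by (rule sum.swap)
  ultimately have "(\<Sum>u\<in>pverts G. f u * m1 u) - (\<Sum>u\<in>pverts G. f u * m2 u)
      = (\<Sum>u\<in>pverts G. \<Sum>v\<in>pverts G. (f u - f v) * \<pi> u v)"
    by (simp add: left_diff_distrib sum_subtractf)
  also have "\<dots> \<le> transport_cost \<pi>"
    unfolding transport_cost_def by (intro sum_mono mult_right_mono lip nn)
  finally show "(\<Sum>u\<in>pverts G. f u * m1 u) - (\<Sum>u\<in>pverts G. f u * m2 u) \<le> transport_cost \<pi>" .
qed

text \<open>Independent sampling from both measures; it serves to show that couplings exist.\<close>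

lemma product_coupling:
  assumes "\<And>u. u \<in> pverts G \<Longrightarrow> 0 \<le> m1 u" "\<And>u. u \<in> pverts G \<Longrightarrow> 0 \<le> m2 u"
    and "(\<Sum>u\<in>pverts G. m1 u) = 1" "(\<Sum>u\<in>pverts G. m2 u) = 1"
  shows "(\<lambda>u v. m1 u * m2 v) \<in> couplings m1 m2"
  using assms
  by (auto simp: couplings_def sum_distrib_left[symmetric] sum_distrib_right[symmetric])

section \<open>Lazy walk measures and their dependence on the idleness\<close>

lemma sum_walk_measure:
  assumes "x \<in> pverts G"
  shows "(\<Sum>u\<in>pverts G. f u * walk_measure p x u)
    = p * f x + (1 - p) / real (out_degree G x) * (\<Sum>u\<in>neighbors x. f u)"
proof -
  have "(\<Sum>u\<in>pverts G. f u * walk_measure p x u)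
      = (\<Sum>u\<in>insert x (neighbors x). f u * walk_measure p x u)"
    using assms neighbors_subset[of x] pair_finite_verts
    by (intro sum.mono_neutral_right) (auto simp: walk_measure_def neighbors_def)
  also have "\<dots> = p * f x + (\<Sum>u\<in>neighbors x. f u * walk_measure p x u)"
    by (simp add: walk_measure_def mult.commute)
  also have "(\<Sum>u\<in>neighbors x. f u * walk_measure p x u)
      = (\<Sum>u\<in>neighbors x. (1 - p) / real (out_degree G x) * f u)"
    by (intro sum.cong refl) (auto simp: walk_measure_def neighbors_def dest: no_loops')
  finally show ?thesis by (simp add: sum_distrib_left)
qed

lemma walk_measure_nonneg: "0 \<le> p \<Longrightarrow> p \<le> 1 \<Longrightarrow> 0 \<le> walk_measure p x u"
  by (simp add: walk_measure_def)

lemma sum_walk_measure_1: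
  assumes "(x, y) \<in> parcs G"
  shows "(\<Sum>u\<in>pverts G. walk_measure p x u) = 1"
  using sum_walk_measure[of x "\<lambda>_. 1" p] out_degree_pos[OF assms] in_arcsD1[OF assms]
  by (auto simp: out_degree_eq_card_neighbors)

text \<open>The arc puts \<open>x\<close> into the graph and makes its degree positive, so the
  moving part really is \<open>1 - p\<close> times an average over the neighbours.\<close>

lemma sum_walk_measure_le:
  assumes xy: "(x, y) \<in> parcs G" and "p \<le> 1" and f: "\<And>u. u \<in> neighbors x \<Longrightarrow> f u \<le> c"
  shows "(\<Sum>u\<in>pverts G. f u * walk_measure p x u) \<le> p * f x + (1 - p) * c"
proof -
  have "(\<Sum>u\<in>neighbors x. f u) \<le> real (out_degree G x) * c"
    using sum_bounded_above[of "neighbors x" f c] f by (simp add: out_degree_eq_card_neighbors)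
  then have "(1 - p) / real (out_degree G x) * (\<Sum>u\<in>neighbors x. f u)
      \<le> (1 - p) / real (out_degree G x) * (real (out_degree G x) * c)"
    using \<open>p \<le> 1\<close> by (intro mult_left_mono) auto
  also have "\<dots> = (1 - p) * c"
    using out_degree_pos[OF xy] by simp
  finally show ?thesis
    using sum_walk_measure[OF in_arcsD1[OF xy], of f p] by simp
qed

lemma sum_walk_measure_ge:
  assumes "(x, y) \<in> parcs G" and "p \<le> 1" and "\<And>u. u \<in> neighbors x \<Longrightarrow> c \<le> f u"
  shows "p * f x + (1 - p) * c \<le> (\<Sum>u\<in>pverts G. f u * walk_measure p x u)"
  using sum_walk_measure_le[OF assms(1,2), of "\<lambda>u. - f u" "- c"] assms(3)
  by (simp add: sum_negf)

lemma walk_couplings_nonempty: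
  assumes "(x, x') \<in> parcs G" "(y, y') \<in> parcs G" "0 \<le> p" "p \<le> 1"
  shows "couplings (walk_measure p x) (walk_measure p y) \<noteq> {}"
  using product_coupling[of "walk_measure p x" "walk_measure p y"]
    sum_walk_measure_1[OF assms(1)] sum_walk_measure_1[OF assms(2)] assms(3,4)
  by (auto simp: walk_measure_nonneg)

text \<open>The \<open>q\<close>-lazy walk is a slowed-down \<open>p\<close>-lazy walk: with weight
  \<open>s q\<close> make the \<open>p\<close>-lazy step, otherwise stay. Comparing the moving
  masses \<open>1 - q\<close> and \<open>1 - p\<close> forces the value of
  \<open>s q\<close>.\<close>

lemma walk_measure_mix:
  assumes "p < 1"
  defines "s \<equiv> \<lambda>q. (1 - q) / (1 - p)"
  shows "walk_measure q x u = s q * walk_measure p x u + (if u = x then 1 - s q else 0)"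
proof -
  have "s q * (1 - p) = 1 - q" using assms(1) by (simp add: s_def)
  then have "q = s q * p + (1 - s q)" "1 - q = s q * (1 - p)"
    by (simp_all add: right_diff_distrib)
  then show ?thesis by (simp add: walk_measure_def)
qed

text \<open>
  Mixing a coupling at idleness \<open>p\<close> with the point mass at \<open>(x, y)\<close> gives a coupling at any
  idleness \<open>q > p\<close>; hence the quotients in the definition of the curvature are monotone.
\<close>

lemma kappa_quotient_mono:
  assumes xy: "(x, y) \<in> parcs G" and p: "0 \<le> p" "p < q" "q < 1"
  shows "kappa p x y / (1 - p) \<le> kappa q x y / (1 - q)"
proof -
  define s where "s = (1 - q) / (1 - p)"
  have s: "0 < s" "s < 1" using p by (auto simp: s_def)
  have yx: "(y, x) \<in> parcs G" using xy by (rule arcs_symmetric)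
  have V: "x \<in> pverts G" "y \<in> pverts G" using xy by (auto dest: wellformed')
  have dxy: "graph_dist x y \<le> 1"
    using graph_dist_le_length[of x "[(x, y)]" y] xy V by (simp add: awalk_Cons_iff awalk_Nil_iff)
  have mix: "walk_measure q z u = s * walk_measure p z u + (if u = z then 1 - s else 0)" for z u
    using walk_measure_mix[of p q z u] p by (simp add: s_def)
  have le: "wasserstein1 (walk_measure q x) (walk_measure q y) \<le> s * transport_cost \<pi> + (1 - s)"
    if "\<pi> \<in> couplings (walk_measure p x) (walk_measure p y)" for \<pi>
  proof -
    \<comment> \<open>The extra idle mass \<open>1 - s\<close> sits at \<open>x\<close> in the first
      marginal and at \<open>y\<close> in the second; carrying it along the edge costs at most
      \<open>1 - s\<close>.\<close>
    let ?\<delta> = "\<lambda>u v. if u = x then if v = y then 1 - s else 0 else 0"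
    let ?\<pi> = "\<lambda>u v. s * \<pi> u v + ?\<delta> u v"
    have "?\<pi> \<in> couplings (walk_measure q x) (walk_measure q y)"
      using that s V pair_finite_verts
      by (auto simp: couplings_def mix sum.distrib sum_distrib_left[symmetric])
    then have "wasserstein1 (walk_measure q x) (walk_measure q y) \<le> transport_cost ?\<pi>"
      by (rule wasserstein1_le)
    also have "\<dots> = s * transport_cost \<pi> + (1 - s) * graph_dist x y"
    proof -
      have "(\<Sum>u\<in>pverts G. \<Sum>v\<in>pverts G. graph_dist u v * ?\<delta> u v)
          = (\<Sum>u\<in>pverts G. if u = x then graph_dist x y * (1 - s) else 0)"
        using V pair_finite_verts 
          by (intro sum.cong refl) (auto simp: if_distrib[of "(*) _"] cong: if_cong)
      also have "\<dots> = graph_dist x y * (1 - s)"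
        using V pair_finite_verts by simp
      finally show ?thesis
        by (simp add: transport_cost_def distrib_left sum.distrib sum_distrib_left mult.assoc
            mult.left_commute mult.commute)
    qed
    also have "\<dots> \<le> s * transport_cost \<pi> + (1 - s)"
      using dxy s mult_left_mono[OF dxy, of "1 - s"] by simp
    finally show ?thesis .
  qed
  let ?Wp = "wasserstein1 (walk_measure p x) (walk_measure p y)"
  let ?Wq = "wasserstein1 (walk_measure q x) (walk_measure q y)"
  \<comment> \<open>No optimal coupling is chosen: the estimate \<open>le\<close>, solved for the
    cost, is a lower bound over all couplings and so passes to the infimum.\<close>
  have "(?Wq - (1 - s)) / s \<le> ?Wp"
    unfolding wasserstein1_eq[of "walk_measure p x"]
  proof (rule cINF_greatest)
    show "couplings (walk_measure p x) (walk_measure p y) \<noteq> {}"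
      using walk_couplings_nonempty[OF xy yx] p by simp
    fix \<pi> assume "\<pi> \<in> couplings (walk_measure p x) (walk_measure p y)"
    from le[OF this] show "(?Wq - (1 - s)) / s \<le> transport_cost \<pi>"
      using s by (simp add: field_simps)
  qed
  \<comment> \<open>The constant \<open>1 - s\<close> is absorbed by the 1 in the definition of
    \<open>kappa\<close>: \<open>1 - ?Wq\<close> is at least \<open>s * (1 - ?Wp)\<close>.\<close>
  then have "s * kappa p x y \<le> kappa q x y"
    using s by (simp add: kappa_def field_simps)
  then have "s * kappa p x y / (1 - q) \<le> kappa q x y / (1 - q)"
    using p by (intro divide_right_mono) auto
  moreover have "s * kappa p x y / (1 - q) = kappa p x y / (1 - p)"
    using p by (simp add: s_def)
  ultimately show ?thesis by simp
qed

end

section \<open>Curvature as a limit in connected graphs\<close>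

locale strongly_connected_pair_graph = pair_graph +
  assumes strongly_connected: "strongly_connected G"
begin

lemma awalk_exists:
  assumes "u \<in> pverts G" "v \<in> pverts G"
  obtains p where "awalk u p v"
  using strongly_connected assms by (auto simp: strongly_connected_def reachable_awalk)

lemma graph_dist_sym:
  assumes "u \<in> pverts G" "v \<in> pverts G"
  shows "graph_dist u v = graph_dist v u"
  by (meson antisym assms awalk_exists graph_dist_sym_le)

lemma graph_dist_ge_1:
  assumes "u \<in> pverts G" "v \<in> pverts G" "u \<noteq> v"
  shows "1 \<le> graph_dist u v"
proof -
  obtain q where "awalk u q v" using assms awalk_exists by blast
  moreover have "1 \<le> real (length p)" if "awalk u p v" for p
    using that \<open>u \<noteq> v\<close> by (cases p) (auto simp: awalk_Nil_iff)
  ultimately show ?thesis by (rule le_graph_dist)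
qed

text \<open>The indicator of \<open>x\<close> is 1-Lipschitz because distinct vertices have distance
  at least 1. Its expectation is at least \<open>p\<close> at \<open>x\<close> and at most
  \<open>1 - p\<close> at \<open>y\<close>, so the transport distance is at least
  \<open>2 * p - 1\<close>. Hence the curvature quotients never exceed 2.\<close>

lemma kappa_le:
  assumes xy: "(x, y) \<in> parcs G" and p: "0 \<le> p" "p \<le> 1"
  shows "kappa p x y \<le> 2 * (1 - p)"
proof -
  let ?f = "\<lambda>u. if u = x then 1 else 0 :: real"
  have yx: "(y, x) \<in> parcs G" using xy by (rule arcs_symmetric)
  have "?f u - ?f v \<le> graph_dist u v" if "u \<in> pverts G" "v \<in> pverts G" for u v
    using graph_dist_ge_1[OF that] graph_dist_nonneg[of u v] by auto
  then have "(\<Sum>u\<in>pverts G. ?f u * walk_measure p x u)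
      - (\<Sum>u\<in>pverts G. ?f u * walk_measure p y u)
      \<le> wasserstein1 (walk_measure p x) (walk_measure p y)"
    using walk_couplings_nonempty[OF xy yx p] by (intro wasserstein1_ge) auto
  moreover have "p \<le> (\<Sum>u\<in>pverts G. ?f u * walk_measure p x u)"
    using sum_walk_measure_ge[OF xy p(2), of 0 ?f] by simp
  moreover have "(\<Sum>u\<in>pverts G. ?f u * walk_measure p y u) \<le> 1 - p"
    using sum_walk_measure_le[OF yx p(2), of ?f 1] no_loops'[OF xy] by simp
  ultimately show ?thesis by (simp add: kappa_def)
qed

text \<open>\<open>Lim\<close> is informative only once convergence is known; it follows from
  monotonicity in the idleness and the bound 2.\<close>

lemma kappa_LLY_tendsto_SUP:
  assumes xy: "(x, y) \<in> parcs G"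
  shows "((\<lambda>p. kappa p x y / (1 - p)) \<longlongrightarrow> (SUP p\<in>{0..<1}. kappa p x y / (1 - p))) (at_left 1)"
proof (rule tendsto_at_left_mono_bounded)
  show "kappa p x y / (1 - p) \<le> kappa q x y / (1 - q)" if "0 \<le> p" "p < q" "q < 1" for p q
    using kappa_quotient_mono[OF xy that] .
  show "kappa p x y / (1 - p) \<le> 2" if "0 \<le> p" "p < 1" for p
    using kappa_le[OF xy, of p] that by (simp add: field_simps)
qed simp

lemma kappa_LLY_eq_SUP:
  "(x, y) \<in> parcs G \<Longrightarrow> kappa_LLY x y = (SUP p\<in>{0..<1}. kappa p x y / (1 - p))"
  unfolding kappa_LLY_def by (intro tendsto_Lim kappa_LLY_tendsto_SUP) auto

lemma kappa_LLY_tendsto: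
  "(x, y) \<in> parcs G \<Longrightarrow> ((\<lambda>p. kappa p x y / (1 - p)) \<longlongrightarrow> kappa_LLY x y) (at_left 1)"
  using kappa_LLY_tendsto_SUP kappa_LLY_eq_SUP by simp

text \<open>One well-chosen idleness thus suffices to bound the curvature from below.\<close>

lemma kappa_LLY_ge_quotient:
  assumes "(x, y) \<in> parcs G" "0 \<le> p" "p < 1"
  shows "kappa p x y / (1 - p) \<le> kappa_LLY x y"
  unfolding kappa_LLY_eq_SUP[OF assms(1)]
proof (rule cSUP_upper)
  show "bdd_above ((\<lambda>p. kappa p x y / (1 - p)) ` {0..<1})"
  proof (rule bdd_aboveI2)
    fix p :: real assume "p \<in> {0..<1}"
    then show "kappa p x y / (1 - p) \<le> 2"
      using kappa_le[OF assms(1), of p] by (simp add: field_simps)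
  qed
qed (use assms in auto)

lemma transport_cost_transpose:
  "transport_cost (\<lambda>u v. \<pi> v u) = transport_cost \<pi>"
  unfolding transport_cost_def by (subst sum.swap) (simp add: graph_dist_sym cong: sum.cong)

lemma wasserstein1_sym: "wasserstein1 m1 m2 = wasserstein1 m2 m1"
proof -
  have "transport_cost ` couplings m1 m2 \<subseteq> transport_cost ` couplings m2 m1" for m1 m2
  proof (rule image_subsetI)
    fix \<pi> assume "\<pi> \<in> couplings m1 m2"
    then have "(\<lambda>u v. \<pi> v u) \<in> couplings m2 m1" by (auto simp: couplings_def)
    then show "transport_cost \<pi> \<in> transport_cost ` couplings m2 m1"
      using transport_cost_transpose[of \<pi>] by (metis imageI)
  qed
  then have "transport_cost ` couplings m1 m2 = transport_cost ` couplings m2 m1"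
    by (intro antisym)
  then show ?thesis by (simp add: wasserstein1_eq)
qed

text \<open>An edge is a pair of opposite arcs; by symmetry only arcs towards the next layer of an
  antitree need to be examined.\<close>

lemma kappa_LLY_sym: "kappa_LLY x y = kappa_LLY y x"
  unfolding kappa_LLY_def kappa_def using wasserstein1_sym by simp

text \<open>At idleness \<open>1 / (d + 1)\<close> the two walk measures coincide, so no mass has to be moved.\<close>

lemma kappa_LLY_twins_ge:
  assumes xy: "(x, y) \<in> parcs G"
    and twins: "insert x (neighbors x) = insert y (neighbors y)"
  shows "1 \<le> kappa_LLY x y"
proof -
  let ?d = "real (out_degree G x)"
  define p where "p = 1 / (?d + 1)"
  have d: "0 < ?d" using out_degree_pos[OF xy] by simp
  then have p: "0 \<le> p" "p < 1" by (auto simp: p_def)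
  have "p * (?d + 1) = 1" using d by (simp add: p_def)
  \<comment> \<open>Idling and moving to any given neighbour have equal probability, so the measure
    is uniform on the closed neighbourhood.\<close>
  then have p_eq: "(1 - p) / ?d = p"
    using d by (simp add: nonzero_divide_eq_eq distrib_left)
  have V: "x \<in> pverts G" using xy by (rule in_arcsD1)
  have "card (insert x (neighbors x)) = card (insert y (neighbors y))"
    using twins by simp
  then have deg: "out_degree G y = out_degree G x"
    by (simp add: out_degree_eq_card_neighbors)
  have wm: "walk_measure p z u = (if u \<in> insert z (neighbors z) then p else 0)"
    if "out_degree G z = out_degree G x" for z u
    using that p_eq by (auto simp: walk_measure_def neighbors_def)
  have eq: "walk_measure p y = walk_measure p x"
    using wm[of x] wm[of y] deg twins by (simp add: fun_eq_iff)
  let ?\<pi> = "\<lambda>u v. if u = v then walk_measure p x u else 0"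
  have "?\<pi> \<in> couplings (walk_measure p x) (walk_measure p y)"
    using p pair_finite_verts by (auto simp: couplings_def eq walk_measure_nonneg)
  from wasserstein1_le[OF this]
  have "wasserstein1 (walk_measure p x) (walk_measure p y) \<le> transport_cost ?\<pi>" .
  also have "\<dots> = 0"
    unfolding transport_cost_def by (intro sum.neutral ballI) auto
  finally have "1 \<le> kappa p x y" by (simp add: kappa_def)
  \<comment> \<open>Dividing by \<open>1 - p\<close>, which lies in (0, 1], cannot decrease a
    nonnegative number.\<close>
  also have "\<dots> \<le> kappa p x y / (1 - p)"
    using calculation p by (simp add: field_simps)
  also have "\<dots> \<le> kappa_LLY x y"
    using xy p by (rule kappa_LLY_ge_quotient)
  finally show ?thesis .
qed

text \<open>
  The Bonnet--Myers argument: along a path on which a 1-Lipschitz function drops by 1 at every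
  step, the lower bounds that Kantorovich duality gives for the transport distances telescope.
\<close>

lemma sum_kappa_LLY_le:
  assumes path: "\<And>k. m \<le> k \<Longrightarrow> k < n \<Longrightarrow> (g k, g (Suc k)) \<in> parcs G"
    and "m < n"
    and lip: "\<And>u v. u \<in> pverts G \<Longrightarrow> v \<in> pverts G \<Longrightarrow> f u - f v \<le> graph_dist u v"
    and drop: "f (g m) - f (g n) = real (n - m)"
  shows "(\<Sum>k=m..<n. kappa_LLY (g k) (g (Suc k))) \<le> 2"
\<comment> \<open>The bound is proved at each fixed idleness, where consecutive edges share a walk
  measure, and then passes to the limit.\<close>
proof (rule tendsto_upperbound)
  show "((\<lambda>p. \<Sum>k=m..<n. kappa p (g k) (g (Suc k)) / (1 - p))
      \<longlongrightarrow> (\<Sum>k=m..<n. kappa_LLY (g k) (g (Suc k)))) (at_left 1)"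
    by (intro tendsto_sum kappa_LLY_tendsto path) auto
  have bound: "(\<Sum>k=m..<n. kappa p (g k) (g (Suc k)) / (1 - p)) \<le> 2" if p: "0 < p" "p < 1" for p
  proof -
    define E where "E k = (\<Sum>u\<in>pverts G. f u * walk_measure p (g k) u)" for k
    have arc_m: "(g m, g (Suc m)) \<in> parcs G" using path \<open>m < n\<close> by simp
    \<comment> \<open>The path gives no arc leaving \<open>g n\<close> forwards, so the reversed
      last arc witnesses its positive degree.\<close>
    have arc_n: "(g n, g (n - 1)) \<in> parcs G"
      using path[of "n - 1"] \<open>m < n\<close> by (auto intro: arcs_symmetric)
    have nb: "f x - 1 \<le> f u" "f u \<le> f x + 1" if "u \<in> neighbors x" for x u
    proof -
      have xu: "(x, u) \<in> parcs G" "(u, x) \<in> parcs G"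
        using that arcs_symmetric by (auto simp: neighbors_def)
      then have V: "x \<in> pverts G" "u \<in> pverts G" by (auto dest: wellformed')
      have "graph_dist x u \<le> 1" "graph_dist u x \<le> 1"
        using graph_dist_le_length[of x "[(x, u)]" u] graph_dist_le_length[of u "[(u, x)]" x] xu V
        by (simp_all add: awalk_Cons_iff awalk_Nil_iff)
      with lip[of x u] lip[of u x] V show "f x - 1 \<le> f u" "f u \<le> f x + 1" by auto
    qed
    have "kappa p (g k) (g (Suc k)) \<le> 1 - (E k - E (Suc k))" if "m \<le> k" "k < n" for k
    proof -
      have arcs: "(g k, g (Suc k)) \<in> parcs G" "(g (Suc k), g k) \<in> parcs G"
        using path that arcs_symmetric by auto
      have "couplings (walk_measure p (g k)) (walk_measure p (g (Suc k))) \<noteq> {}"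
        using walk_couplings_nonempty[OF arcs] p by simp
      from wasserstein1_ge[OF this lip] show ?thesis by (simp add: kappa_def E_def)
    qed
    then have "(\<Sum>k=m..<n. kappa p (g k) (g (Suc k))) \<le> (\<Sum>k=m..<n. 1 - (E k - E (Suc k)))"
      by (intro sum_mono) auto
    also have "\<dots> = real (n - m) - (\<Sum>k=m..<n. E k - E (Suc k))"
      by (simp add: sum_subtractf)
    also have "(\<Sum>k=m..<n. E k - E (Suc k)) = E m - E n"
      using sum_Suc_diff'[of m n "\<lambda>k. - E k"] \<open>m < n\<close> by simp
    finally have "(\<Sum>k=m..<n. kappa p (g k) (g (Suc k))) \<le> real (n - m) - (E m - E n)" .
    moreover have "f (g m) - (1 - p) \<le> E m"
      using sum_walk_measure_ge[OF arc_m, of p "f (g m) - 1" f] nb(1) p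
      by (simp add: E_def algebra_simps)
    moreover have "E n \<le> f (g n) + (1 - p)"
      using sum_walk_measure_le[OF arc_n, of p f "f (g n) + 1"] nb(2) p
      by (simp add: E_def algebra_simps)
    \<comment> \<open>Each end of the path loses \<open>1 - p\<close>, since \<open>f\<close> varies
      by at most 1 between neighbours; this is the source of the factor 2. The drop of
      \<open>f\<close> cancels \<open>real (n - m)\<close>.\<close>
    ultimately have "(\<Sum>k=m..<n. kappa p (g k) (g (Suc k))) \<le> 2 * (1 - p)"
      using drop by simp
    then show ?thesis
      using p by (simp add: sum_divide_distrib[symmetric] field_simps)
  qed
  show "\<forall>\<^sub>F p in at_left 1. (\<Sum>k=m..<n. kappa p (g k) (g (Suc k)) / (1 - p)) \<le> 2"
    unfolding eventually_at_left_field using bound by (intro exI[of _ 0]) auto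
qed simp

end

section \<open>Walks, distances and diameter of antitrees\<close>

locale positive_antitree =
  fixes N :: nat and a :: "nat \<Rightarrow> nat"
  assumes layers_pos: "\<And>k. 1 \<le> k \<Longrightarrow> k \<le> N \<Longrightarrow> 0 < a k"
    and length_pos: "0 < N"
begin

sublocale pair_graph "antitree N a" by (rule pair_graph_antitree)

abbreviation "V \<equiv> antitree_verts N a"

lemma pverts_antitree [simp]: "pverts (antitree N a) = V"
  by (simp add: antitree_def)

lemma parcs_antitree_iff:
  "(x, y) \<in> parcs (antitree N a) \<longleftrightarrow> x \<in> V \<and> y \<in> V \<and> x \<noteq> y
    \<and> (fst x = fst y \<or> fst y = Suc (fst x) \<or> fst x = Suc (fst y))"
  by (auto simp: antitree_def)

lemma base_vertex: "1 \<le> k \<Longrightarrow> k \<le> N \<Longrightarrow> (k, 1) \<in> V"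
  using layers_pos by (auto simp: antitree_verts_def Suc_le_eq)

lemma fst_vertex: "u \<in> V \<Longrightarrow> 1 \<le> fst u \<and> fst u \<le> N"
  by (auto simp: antitree_verts_def)

text \<open>Consecutive layers are completely joined, so one can climb through the base vertices
  \<open>(k, 1)\<close> and enter \<open>v\<close> on the last step. The index difference is
  \<open>Suc n\<close> because distinct vertices of one layer are at distance 1, not 0.\<close>

lemma ascending_awalk:
  assumes "u \<in> V" "v \<in> V" "fst v = fst u + Suc n"
  shows "\<exists>p. awalk u p v \<and> length p = Suc n"
  using assms
proof (induction n arbitrary: u)
  case 0
  then have "(u, v) \<in> parcs (antitree N a)" by (auto simp: parcs_antitree_iff)
  then show ?case using 0
    by (intro exI[of _ "[(u, v)]"]) (simp add: awalk_Cons_iff awalk_Nil_iff)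
next
  case (Suc n)
  let ?w = "(Suc (fst u), 1)"
  have w: "?w \<in> V"
    using Suc.prems fst_vertex[of v] by (intro base_vertex) auto
  then obtain p where "awalk ?w p v" "length p = Suc n"
    using Suc by fastforce
  moreover have "(u, ?w) \<in> parcs (antitree N a)"
    using w Suc.prems(1) by (cases u) (simp add: parcs_antitree_iff)
  ultimately show ?case
    using Suc.prems by (intro exI[of _ "(u, ?w) # p"]) (auto simp: awalk_Cons_iff)
qed

lemma awalk_antitree:
  assumes "u \<in> V" "v \<in> V" "u \<noteq> v"
  shows "\<exists>p. awalk u p v \<and> real (length p) = max 1 \<bar>real (fst u) - real (fst v)\<bar>"
proof (cases "fst u" "fst v" rule: linorder_cases)
  case less
  then obtain p where "awalk u p v" "length p = Suc (fst v - fst u - 1)"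
    using ascending_awalk[of u v "fst v - fst u - 1"] assms by auto
  with less show ?thesis by (intro exI[of _ p]) (auto simp: of_nat_diff)
next
  case equal
  then have "(u, v) \<in> parcs (antitree N a)" using assms by (auto simp: parcs_antitree_iff)
  then show ?thesis using assms equal
    by (intro exI[of _ "[(u, v)]"]) (simp add: awalk_Cons_iff awalk_Nil_iff)
next
  case greater
  then obtain p where "awalk v p u" "length p = Suc (fst u - fst v - 1)"
    using ascending_awalk[of v u "fst u - fst v - 1"] assms by auto
  with greater show ?thesis by (intro exI[of _ "rev_path p"]) (auto simp: of_nat_diff)
qed

sublocale strongly_connected_pair_graph "antitree N a"
proof unfold_locales
  have "u \<rightarrow>\<^sup>*\<^bsub>with_proj (antitree N a)\<^esub> v" if "u \<in> V" "v \<in> V" for u v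
  proof (cases "u = v")
    case True
    then show ?thesis using that
      by (auto simp: reachable_awalk awalk_Nil_iff intro!: exI[of _ "[]"])
  next
    case False
    then show ?thesis using awalk_antitree[OF that] by (auto simp: reachable_awalk)
  qed
  \<comment> \<open>Strong connectedness includes having at least one vertex.\<close>
  moreover have "V \<noteq> {}" using base_vertex[of 1] length_pos by auto
  ultimately show "strongly_connected (antitree N a)"
    by (intro strongly_connectedI) auto
qed

text \<open>Each arc changes the layer index by at most 1.\<close>

lemma fst_diff_le_length:
  "awalk u p v \<Longrightarrow> \<bar>real (fst u) - real (fst v)\<bar> \<le> real (length p)"
proof (induction p arbitrary: u)
  case Nil
  then show ?case by (simp add: awalk_Nil_iff)
next
  case (Cons e p)
  then have "e \<in> parcs (antitree N a)" "fst e = u" "awalk (snd e) p v"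
    by (auto simp: awalk_Cons_iff)
  moreover from this have "\<bar>real (fst u) - real (fst (snd e))\<bar> \<le> 1"
    by (cases e) (auto simp: parcs_antitree_iff)
  ultimately show ?case using Cons.IH[of "snd e"] by simp
qed

lemma graph_dist_ge_fst_diff:
  assumes "u \<in> V" "v \<in> V"
  shows "\<bar>real (fst u) - real (fst v)\<bar> \<le> graph_dist u v"
proof -
  obtain q where "awalk u q v" using awalk_exists[of u v] assms by auto
  then show ?thesis by (rule le_graph_dist) (rule fst_diff_le_length)
qed

text \<open>The extreme layers realise the diameter. With \<open>2 \<le> N\<close> the distance 1
  inside a layer does not exceed \<open>N - 1\<close>.\<close>

lemma graph_diam_antitree:
  assumes "2 \<le> N"
  shows "graph_diam = real N - 1"
  unfolding graph_diam_def
proof (rule Max_eqI)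
  show "finite ((\<lambda>(x, y). graph_dist x y) ` (pverts (antitree N a) \<times> pverts (antitree N a)))"
    using pair_finite_verts by simp
  fix d assume "d \<in> (\<lambda>(x, y). graph_dist x y) ` (pverts (antitree N a) \<times> pverts (antitree N a))"
  then obtain u v where uv: "u \<in> V" "v \<in> V" "d = graph_dist u v" by auto
  show "d \<le> real N - 1"
  proof (cases "u = v")
    case True
    then show ?thesis using uv assms by simp
  next
    case False
    then obtain p where p: "awalk u p v"
      "real (length p) = max 1 \<bar>real (fst u) - real (fst v)\<bar>"
      using awalk_antitree uv by blast
    then have "d \<le> max 1 \<bar>real (fst u) - real (fst v)\<bar>"
      using graph_dist_le_length[OF p(1)] uv by simp
    also have "\<dots> \<le> real N - 1"
      using fst_vertex[OF uv(1)] fst_vertex[OF uv(2)] assms by auto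
    finally show ?thesis .
  qed
next
  have V: "(1, 1) \<in> V" "(N, 1) \<in> V" using base_vertex length_pos by auto
  have "graph_dist (1, 1) (N, 1) \<le> real N - 1"
    using awalk_antitree[OF V] assms graph_dist_le_length[of "(1, 1)" _ "(N, 1)"] by fastforce
  moreover have "real N - 1 \<le> graph_dist (1, 1) (N, 1)"
    using graph_dist_ge_fst_diff[OF V] assms by simp
  ultimately show "real N - 1
      \<in> (\<lambda>(x, y). graph_dist x y) ` (pverts (antitree N a) \<times> pverts (antitree N a))"
    using V by (intro image_eqI[of _ _ "((1, 1), (N, 1))"]) auto
qed

section \<open>Curvature of spherical and radial edges\<close>

lemma spherical_kappa_LLY_ge:
  assumes "(x, y) \<in> parcs (antitree N a)" "fst x = fst y"
  shows "1 \<le> kappa_LLY x y"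
  using assms(1)
proof (rule kappa_LLY_twins_ge)
  show "insert x (neighbors x) = insert y (neighbors y)"
    using assms unfolding neighbors_def parcs_antitree_iff by auto
qed

lemma radial_kappa_LLY_eq:
  assumes lower: "\<And>x y. (x, y) \<in> radial_edges N a \<Longrightarrow> c \<le> kappa_LLY x y"
    and c: "c * (real N - 1) = 2"
    and xy: "(x, y) \<in> parcs (antitree N a)" "fst y = Suc (fst x)"
  shows "kappa_LLY x y = c"
proof -
  \<comment> \<open>The path uses \<open>x\<close> and \<open>y\<close> in their own layers and base
    vertices elsewhere, so the given edge is one of its steps.\<close>
  define g where "g k = (if k = fst x then x else if k = fst y then y else (k, 1))" for k
  have V: "x \<in> V" "y \<in> V" using xy(1) by (auto simp: parcs_antitree_iff)
  have fst_g: "fst (g k) = k" for k by (simp add: g_def)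
  have gV: "g k \<in> V" if "1 \<le> k" "k \<le> N" for k
    using V base_vertex[OF that] by (simp add: g_def)
  have arc: "(g k, g (Suc k)) \<in> parcs (antitree N a)" if "1 \<le> k" "k < N" for k
    using that gV[of k] gV[of "Suc k"] fst_g[of k] fst_g[of "Suc k"]
    unfolding parcs_antitree_iff by (metis Suc_leI le_SucI less_imp_le n_not_Suc_n)
  have x: "fst x \<in> {1..<N}" using fst_vertex[OF V(1)] fst_vertex[OF V(2)] xy(2) by auto
  have geq: "g (fst x) = x" "g (Suc (fst x)) = y" using xy(2) by (auto simp: g_def)
  have kc: "c \<le> kappa_LLY (g k) (g (Suc k))" if "k \<in> {1..<N}" for k
    using lower arc[of k] that fst_g by (auto simp: radial_edges_def)
  have "(\<Sum>k=1..<N. kappa_LLY (g k) (g (Suc k))) \<le> 2"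
  \<comment> \<open>The sign is negative because the layer index rises along \<open>g\<close>,
    whereas the test function has to drop.\<close>
  proof (rule sum_kappa_LLY_le[where f = "\<lambda>u. - real (fst u)"])
    show "1 < N" using x by auto
    show "- real (fst u) - - real (fst v) \<le> graph_dist u v"
      if "u \<in> pverts (antitree N a)" "v \<in> pverts (antitree N a)" for u v
      using graph_dist_ge_fst_diff[of u v] that by simp
    show "- real (fst (g 1)) - - real (fst (g N)) = real (N - 1)"
      using \<open>1 < N\<close> by (simp add: fst_g of_nat_diff)
  qed (use arc in auto)
  also have "2 = (\<Sum>k=1..<N. c)"
    using c x by (simp add: of_nat_diff mult.commute)
  finally have "(\<Sum>k=1..<N. kappa_LLY (g k) (g (Suc k)) - c) \<le> 0"
    by (simp add: sum_subtractf)
  \<comment> \<open>All excesses over \<open>c\<close> are nonnegative and their sum is at most 0,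
    so the excess of this edge is at most 0.\<close>
  moreover have "kappa_LLY (g (fst x)) (g (Suc (fst x))) - c
      \<le> (\<Sum>k=1..<N. kappa_LLY (g k) (g (Suc k)) - c)"
    using x kc by (intro member_le_sum) auto
  ultimately have "kappa_LLY x y \<le> c" using geq by simp
  moreover have "c \<le> kappa_LLY x y" using kc[OF x] geq by simp
  ultimately show ?thesis by simp
qed

lemma bonnet_myers_sharp_iff:
  assumes "3 \<le> N"
  shows "bonnet_myers_sharp \<longleftrightarrow> (\<forall>(x, y) \<in> radial_edges N a. kappa_LLY x y = 2 / graph_diam)"
proof -
  let ?A = "(\<lambda>(x, y). kappa_LLY x y) ` parcs (antitree N a)"
  define c where "c = 2 / graph_diam"
  \<comment> \<open>The first fact matches the \<open>N - 1\<close> edges of a path through all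
    layers. The second uses \<open>3 \<le> N\<close> and keeps spherical edges, of curvature at
    least 1, from undercutting \<open>c\<close>.\<close>
  have c: "c * (real N - 1) = 2" "c \<le> 1"
    using assms by (simp_all add: c_def graph_diam_antitree divide_simps)
  have fin: "finite ?A" using pair_finite_arcs by simp
  show ?thesis
  proof
    assume "bonnet_myers_sharp"
    then have "Inf ?A = c" by (simp add: bonnet_myers_sharp_def c_def)
    then have lower: "c \<le> kappa_LLY x y" if "(x, y) \<in> radial_edges N a" for x y
      using that cInf_lower[of "kappa_LLY x y" ?A] fin by (force simp: radial_edges_def)
    have up: "kappa_LLY x y = c"
      if "(x, y) \<in> parcs (antitree N a)" "fst y = Suc (fst x)" for x y
      using lower c(1) that by (rule radial_kappa_LLY_eq)
    have "kappa_LLY x y = c" if "(x, y) \<in> radial_edges N a" for x y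
    proof -
      have xy: "(x, y) \<in> parcs (antitree N a)" "(y, x) \<in> parcs (antitree N a)"
        and "fst y = Suc (fst x) \<or> fst x = Suc (fst y)"
        using that by (auto simp: radial_edges_def parcs_antitree_iff)
      then show ?thesis
        using up[OF xy(1)] up[OF xy(2)] kappa_LLY_sym[of x y] by argo
    qed
    then show "\<forall>(x, y) \<in> radial_edges N a. kappa_LLY x y = 2 / graph_diam"
      by (auto simp: c_def)
  next
    assume "\<forall>(x, y) \<in> radial_edges N a. kappa_LLY x y = 2 / graph_diam"
    then have radial: "kappa_LLY x y = c" if "(x, y) \<in> radial_edges N a" for x y
      using that by (auto simp: c_def)
    \<comment> \<open>A concrete radial edge shows that the value \<open>c\<close> is attained, so
      the infimum equals \<open>c\<close> and does not merely stay above it.\<close>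
    have edge: "((1, 1), (2, 1)) \<in> radial_edges N a"
      using assms base_vertex[of 1] base_vertex[of 2]
      by (auto simp: radial_edges_def parcs_antitree_iff)
    have "Inf ?A = c"
    proof (rule cInf_eq_minimum)
      show "c \<in> ?A"
        using radial[OF edge] edge
        by (intro image_eqI[of _ _ "((1, 1), (2, 1))"]) (auto simp: radial_edges_def)
      fix r assume "r \<in> ?A"
      then obtain x y where xy: "(x, y) \<in> parcs (antitree N a)" "r = kappa_LLY x y" by auto
      show "c \<le> r"
      proof (cases "fst x = fst y")
        case True
        then show ?thesis using spherical_kappa_LLY_ge[OF xy(1)] xy(2) c(2) by simp
      next
        case False
        then show ?thesis using radial[of x y] xy by (auto simp: radial_edges_def)
      qed
    qed
    then show "bonnet_myers_sharp" by (simp add: bonnet_myers_sharp_def c_def)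
  qed
qed

end

theorem theorem4p3:
  fixes N :: nat and a :: "nat \<Rightarrow> nat"
  assumes "odd N" and "3 \<le> N"
    and "\<forall>k\<in>{1..N}. 0 < a k"
    and "a 1 = 1"
    and "\<forall>k\<in>{1..N}. a k = a (N + 1 - k)"
  shows "pair_graph.bonnet_myers_sharp (antitree N a) \<longleftrightarrow>
    (\<forall>(x, y) \<in> radial_edges N a.
       pair_graph.kappa_LLY (antitree N a) x y = 2 / pair_graph.graph_diam (antitree N a))"
proof -
  interpret positive_antitree N a
    using assms(2,3) by unfold_locales auto
  show ?thesis using assms(2) by (rule bonnet_myers_sharp_iff)
qed

end
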